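(* Let $X \subset \mathbb{R}^n$ be an open set and let $\phi : X \to \mathbb{R}^m$ be a function. If $\phi$ has an R-FISCIDS representation, then $\phi$ is (real-)analytic on $X$.
   Context: R-FISCIDS representations. Let $\phi : X \to \mathbb{R}^m$ with $X \subset \mathbb{R}^n$ open. Consider an $N$-dimensional system with fixed initial state $z_0 \in \mathbb{R}^N$ (independent of $\xi$) and constant input $\xi \in X$: $$\dot z(\tau) = F(z(\tau))\,\xi, \quad z(0) = z_0, \qquad y(\tau) = h(z(\tau)),$$ where $F : Z \to \mathbb{R}^{N\times n}$ and $h : Z \to \mathbb{R}^m$ are defined on an open set $Z \subset \mathbb{R}^N$ containing $z_0$. Let $z(\tau;\xi)$ and $y(\tau;\xi)$ denote its state trajectory (in $Z$) and output. If for every $\xi \in X$ the trajectory $z(\tau;\xi)$ is defined for all $\tau \in [0,1]$ and $y(1;\xi) = \phi(\xi)$, the system is called a FISCIDS (fixed-initial-state constant-input dynamical system) representation of $\phi$. It is an R-FISCIDS (rational) representation if the entries of $F$ and $h$ are rational functions of $z$ (quotients of polynomials whose denominators do not vanish on $Z$). *)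

theory Defs
  imports "HOL-Analysis.Analysis"
begin

definition mv_monom :: "('n \<Rightarrow> nat) \<Rightarrow> real ^ 'n \<Rightarrow> real"
  where "mv_monom \<alpha> v = (\<Prod>i\<in>UNIV. (v $ i) ^ \<alpha> i)"

(* Local expansion into a convergent multivariate power series, indexed by all multi-indices.
   The sum is unordered, hence absolutely convergent. Requiring the ball to lie inside X makes
   the notion depend only on the values of f on X; it is intended for open X. *)
definition real_analytic_on :: "(real ^ 'n \<Rightarrow> real ^ 'm) \<Rightarrow> (real ^ 'n) set \<Rightarrow> bool"
  where "real_analytic_on f X \<longleftrightarrow>
    (\<forall>x\<in>X. \<exists>r>0. ball x r \<subseteq> X \<and>
      (\<exists>c :: ('n \<Rightarrow> nat) \<Rightarrow> real ^ 'm. \<forall>y\<in>ball x r.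
        ((\<lambda>\<alpha>. mv_monom \<alpha> (y - x) *\<^sub>R c \<alpha>) has_sum f y) UNIV))"

definition rational_on :: "(real ^ 'k) set \<Rightarrow> (real ^ 'k \<Rightarrow> real) \<Rightarrow> bool"
  where "rational_on Z f \<longleftrightarrow>
    (\<exists>p q. real_polynomial_function p \<and> real_polynomial_function q \<and>
      (\<forall>z\<in>Z. q z \<noteq> 0 \<and> f z = p z / q z))"

(* At the end points of the time interval the derivative is one-sided. *)
definition is_trajectory ::
    "(real ^ 'k) set \<Rightarrow> (real ^ 'k \<Rightarrow> real ^ 'n ^ 'k) \<Rightarrow> real ^ 'k \<Rightarrow> real ^ 'n \<Rightarrow> (real \<Rightarrow> real ^ 'k) \<Rightarrow> bool"
  where "is_trajectory Z F z0 \<xi> z \<longleftrightarrow>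
    z 0 = z0 \<and>
    (\<forall>\<tau>\<in>{0..1}. z \<tau> \<in> Z \<and>
      (z has_vector_derivative (F (z \<tau>) *v \<xi>)) (at \<tau> within {0..1}))"

(* The state dimension is CARD('k). For locally Lipschitz F, in particular for rational F,
   the trajectory is unique on [0,1], so the existential quantifier denotes the trajectory. *)
definition is_FISCIDS ::
    "(real ^ 'n) set \<Rightarrow> (real ^ 'n \<Rightarrow> real ^ 'm) \<Rightarrow>
     (real ^ 'k) set \<Rightarrow> (real ^ 'k \<Rightarrow> real ^ 'n ^ 'k) \<Rightarrow> (real ^ 'k \<Rightarrow> real ^ 'm) \<Rightarrow> real ^ 'k \<Rightarrow> bool"
  where "is_FISCIDS X \<phi> Z F h z0 \<longleftrightarrow>
    open Z \<and> z0 \<in> Z \<and>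
    (\<forall>\<xi>\<in>X. \<exists>z. is_trajectory Z F z0 \<xi> z \<and> h (z 1) = \<phi> \<xi>)"

definition is_R_FISCIDS ::
    "(real ^ 'n) set \<Rightarrow> (real ^ 'n \<Rightarrow> real ^ 'm) \<Rightarrow>
     (real ^ 'k) set \<Rightarrow> (real ^ 'k \<Rightarrow> real ^ 'n ^ 'k) \<Rightarrow> (real ^ 'k \<Rightarrow> real ^ 'm) \<Rightarrow> real ^ 'k \<Rightarrow> bool"
  where "is_R_FISCIDS X \<phi> Z F h z0 \<longleftrightarrow>
    is_FISCIDS X \<phi> Z F h z0 \<and>
    (\<forall>i j. rational_on Z (\<lambda>z. F z $ i $ j)) \<and>
    (\<forall>i. rational_on Z (\<lambda>z. h z $ i))"

end

theory Submission
  imports Defs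
begin

text \<open>
  Near a parameter \<open>x\<close> the trajectories are obtained by solving the differential equation once,
  in a Banach space whose elements behave like power series in the rescaled parameter
  \<open>u = (\<xi> - x) / \<rho>\<close>. Adjoining \<open>\<xi>\<close> and the reciprocal of a common denominator to the state makes
  the vector field polynomial, so it extends to this space through its convolution product. For
  small \<open>\<rho>\<close> the extended initial value is close to the embedded initial value at \<open>x\<close>, whose solution
  exists on \<open>[0,1]\<close>; hence the extended solution also exists on \<open>[0,1]\<close>. Evaluation at \<open>u\<close> is
  bounded, linear and multiplicative, so it maps the extended solution to a solution for the
  parameter \<open>\<xi>\<close>, which by uniqueness is the given trajectory. Its endpoint is therefore given by
  evaluating a power series.
\<close>

section \<open>Power series as functionals on bounded families\<close>

text \<open>The multi-indices carry a product of finitely many discrete topologies, which is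
  discrete. Hence every bounded family is continuous, and \<open>\<Rightarrow>\<^sub>C\<close>
  contains all bounded families.\<close>

lemma open_multi_index: "open (S :: ('n::finite \<Rightarrow> nat) set)"
proof -
  have "open {f}" for f :: "'n \<Rightarrow> nat"
  proof -
    have "{f} = PiE UNIV (\<lambda>i. {f i})" by (auto simp: PiE_def Pi_def)
    moreover have "open (PiE UNIV (\<lambda>i. {f i}))"
      by (intro open_PiE) (auto intro: open_discrete)
    ultimately show ?thesis by simp
  qed
  then have "open (\<Union>f\<in>S. {f})" by blast
  then show ?thesis by simp
qed

lemma bcontfun_multi_index:
  fixes f :: "('n::finite \<Rightarrow> nat) \<Rightarrow> real"
  assumes "\<And>\<alpha>. \<bar>f \<alpha>\<bar> \<le> B"
  shows "apply_bcontfun (Bcontfun f) = f"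
proof (rule Bcontfun_inverse, rule bcontfun_normI)
  show "continuous_on UNIV f"
    by (simp add: continuous_on_open_vimage open_multi_index)
qed (use assms in auto)

text \<open>
  The dual of the bounded functions on the multi-indices stands in for the space of absolutely
  summable coefficient families, which it contains. It is already a Banach space in the library.
  The functionals that do not come from a summable family do no harm: in the sup norm, the family of
  monomials at a point of the open unit polydisc is the sum of its finitely supported parts, so every
  functional is a power series there (see \<open>has_sum_series\<close>).
\<close>
type_synonym 'n series = "(('n \<Rightarrow> nat) \<Rightarrow>\<^sub>C real) \<Rightarrow>\<^sub>L real"

section \<open>Convolution of series\<close>

definition shift :: "('n::finite \<Rightarrow> nat) \<Rightarrow> (('n \<Rightarrow> nat) \<Rightarrow>\<^sub>C real) \<Rightarrow> (('n \<Rightarrow> nat) \<Rightarrow>\<^sub>C real)"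
  where "shift \<alpha> w = Bcontfun (\<lambda>\<beta>. w (\<lambda>i. \<alpha> i + \<beta> i))"

lemma abs_bcontfun_le: "\<bar>apply_bcontfun (w :: _ \<Rightarrow>\<^sub>C real) \<alpha>\<bar> \<le> norm w"
  using norm_bounded[of w \<alpha>] by simp

lemma shift_apply [simp]: "shift \<alpha> w \<beta> = w (\<lambda>i. \<alpha> i + \<beta> i)"
  by (simp add: shift_def bcontfun_multi_index[OF abs_bcontfun_le])

lemma norm_shift_le: "norm (shift \<alpha> w) \<le> norm w"
  by (rule norm_bound) (simp add: abs_bcontfun_le)

lemma shift_add: "shift \<alpha> (v + w) = shift \<alpha> v + shift \<alpha> w"
  and shift_scaleR: "shift \<alpha> (c *\<^sub>R w) = c *\<^sub>R shift \<alpha> w"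
  by (auto intro!: bcontfun_eqI)

text \<open>For \<open>b\<close> coming from a summable family b_\<beta>, the entry at \<alpha> is
  the sum of b_\<beta> w_(\<alpha>+\<beta>) over \<beta>. Pairing this family with an
  \<open>a\<close> of the same kind gives the double sum of a_\<alpha> b_\<beta>
  w_(\<alpha>+\<beta>), the Cauchy product tested on \<open>w\<close>.\<close>

definition conv_fun :: "'n::finite series \<Rightarrow> (('n \<Rightarrow> nat) \<Rightarrow>\<^sub>C real) \<Rightarrow> (('n \<Rightarrow> nat) \<Rightarrow>\<^sub>C real)"
  where "conv_fun b w = Bcontfun (\<lambda>\<alpha>. b (shift \<alpha> w))"

lemma abs_series_shift_le: "\<bar>blinfun_apply (b :: 'n::finite series) (shift \<alpha> w)\<bar> \<le> norm b * norm w"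
proof -
  have "\<bar>b (shift \<alpha> w)\<bar> \<le> norm b * norm (shift \<alpha> w)"
    using norm_blinfun[of b "shift \<alpha> w"] by simp
  also have "\<dots> \<le> norm b * norm w"
    by (intro mult_left_mono norm_shift_le) simp
  finally show ?thesis .
qed

lemma conv_fun_apply [simp]: "conv_fun b w \<alpha> = b (shift \<alpha> w)"
  by (simp add: conv_fun_def bcontfun_multi_index[OF abs_series_shift_le])

lemma norm_conv_fun_le: "norm (conv_fun b w) \<le> norm w * norm b"
  by (rule norm_bound) (simp add: abs_series_shift_le mult.commute)

lemma bounded_linear_conv_fun: "bounded_linear (conv_fun b)"
  by (rule bounded_linear_intro[where K = "norm b"])
    (auto intro!: bcontfun_eqI simp: shift_add shift_scaleR blinfun.bilinear_simps norm_conv_fun_le)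

text \<open>Bundled as an operator, so that the product of series becomes a composition and inherits
  bounded bilinearity from it.\<close>

definition conv_op :: "'n::finite series \<Rightarrow> (('n \<Rightarrow> nat) \<Rightarrow>\<^sub>C real) \<Rightarrow>\<^sub>L (('n \<Rightarrow> nat) \<Rightarrow>\<^sub>C real)"
  where "conv_op b = Blinfun (conv_fun b)"

lemma conv_op_apply [simp]: "blinfun_apply (conv_op b) = conv_fun b"
  by (simp add: conv_op_def bounded_linear_Blinfun_apply bounded_linear_conv_fun)

lemma bounded_linear_conv_op: "bounded_linear conv_op"
proof (rule bounded_linear_intro[where K = 1])
  show "norm (conv_op b) \<le> norm b * 1" for b :: "'a series"
    by (rule norm_blinfun_bound) (use norm_conv_fun_le[of b] in \<open>auto simp: mult.commute\<close>)
qed (auto intro!: blinfun_eqI bcontfun_eqI simp: blinfun.bilinear_simps)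

text \<open>The Arens product: it extends the convolution of coefficient families.\<close>
definition conv :: "'n::finite series \<Rightarrow> 'n series \<Rightarrow> 'n series"
  where "conv a b = a o\<^sub>L conv_op b"

lemma conv_apply: "conv a b w = a (conv_fun b w)"
  by (simp add: conv_def)

lemma bounded_bilinear_conv: "bounded_bilinear conv"
  unfolding conv_def
  using bounded_bilinear.comp[OF bounded_bilinear_blinfun_compose bounded_linear_ident bounded_linear_conv_op] .

text \<open>Read as a power series, this functional is the single monomial with exponent \<alpha>:
  for \<open>u\<close> in the closed unit polydisc, its value at \<open>monoms u\<close> is
  \<open>mv_monom \<alpha> u\<close>.\<close>

definition coeff_at :: "('n::finite \<Rightarrow> nat) \<Rightarrow> 'n series"
  where "coeff_at \<alpha> = Blinfun (\<lambda>w. apply_bcontfun w \<alpha>)"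

lemma coeff_at_apply [simp]: "coeff_at \<alpha> w = w \<alpha>"
proof -
  have "bounded_linear (\<lambda>w. apply_bcontfun w \<alpha> :: real)"
    by (rule bounded_linear_intro[where K = 1]) (auto simp: abs_bcontfun_le)
  then show ?thesis by (simp add: coeff_at_def bounded_linear_Blinfun_apply)
qed

abbreviation one_series :: "'n::finite series" where "one_series \<equiv> coeff_at (\<lambda>_. 0)"

lemma conv_one_one: "conv one_series one_series = one_series"
  by (auto intro!: blinfun_eqI simp: conv_apply)

section \<open>Evaluation at points of the polydisc\<close>

definition monoms :: "real ^ 'n \<Rightarrow> ('n::finite \<Rightarrow> nat) \<Rightarrow>\<^sub>C real"
  where "monoms u = Bcontfun (\<lambda>\<alpha>. mv_monom \<alpha> u)"

definition polydisc :: "real \<Rightarrow> (real ^ 'n) set"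
  where "polydisc \<rho> = {u. \<forall>i. \<bar>u $ i\<bar> \<le> \<rho>}"

lemma polydisc_mono: "u \<in> polydisc \<rho> \<Longrightarrow> \<rho> \<le> \<sigma> \<Longrightarrow> u \<in> polydisc \<sigma>"
  unfolding polydisc_def by (auto intro: order_trans)

text \<open>Every factor is at most 1, so the product is bounded by any one of them. The index
  \<open>i\<close> is left free so that a coordinate with a large exponent can be chosen.\<close>

lemma abs_mv_monom_le:
  fixes u :: "real ^ 'n"
  assumes "u \<in> polydisc \<rho>" "0 \<le> \<rho>" "\<rho> \<le> 1"
  shows "\<bar>mv_monom \<alpha> u\<bar> \<le> \<rho> ^ \<alpha> i"
proof -
  have le: "\<bar>u $ j\<bar> ^ \<alpha> j \<le> \<rho> ^ \<alpha> j" for j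
    using assms by (intro power_mono) (auto simp: polydisc_def)
  have "\<bar>mv_monom \<alpha> u\<bar> = (\<Prod>j\<in>UNIV. \<bar>u $ j\<bar> ^ \<alpha> j)"
    by (simp add: mv_monom_def abs_prod power_abs)
  also have "\<dots> \<le> (\<Prod>j\<in>UNIV. if j = i then \<rho> ^ \<alpha> i else 1)"
  proof (intro prod_mono)
    fix j :: 'n
    have "\<rho> ^ \<alpha> j \<le> 1" using assms by (simp add: power_le_one)
    with le[of j] show "0 \<le> \<bar>u $ j\<bar> ^ \<alpha> j \<and> \<bar>u $ j\<bar> ^ \<alpha> j \<le> (if j = i then \<rho> ^ \<alpha> i else 1)"
      by auto
  qed
  finally show ?thesis by simp
qed

lemma mv_monom_add: "mv_monom (\<lambda>i. \<alpha> i + \<beta> i) u = mv_monom \<alpha> u * mv_monom \<beta> u"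
  by (simp add: mv_monom_def power_add prod.distrib)

text \<open>Outside the closed unit polydisc the monomials are unbounded, and
  \<open>Bcontfun\<close> has no specified value there.\<close>

lemma monoms_apply:
  assumes "u \<in> polydisc 1"
  shows "monoms u \<alpha> = mv_monom \<alpha> u"
  unfolding monoms_def using abs_mv_monom_le[OF assms]
  by (subst bcontfun_multi_index[where B = 1]) auto

text \<open>Shifting \<open>monoms u\<close> by \<alpha> multiplies it by a scalar, the monomial of
  exponent \<alpha>. This makes evaluation at \<open>u\<close> multiplicative for every functional,
  including those that come from no summable family.\<close>

lemma conv_fun_monoms:
  assumes "u \<in> polydisc 1"
  shows "conv_fun b (monoms u) = b (monoms u) *\<^sub>R monoms u"
proof (rule bcontfun_eqI)
  fix \<alpha>
  have "shift \<alpha> (monoms u) = mv_monom \<alpha> u *\<^sub>R monoms u"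
    by (rule bcontfun_eqI) (simp add: monoms_apply[OF assms] mv_monom_add)
  then show "conv_fun b (monoms u) \<alpha> = (b (monoms u) *\<^sub>R monoms u) \<alpha>"
    by (simp add: blinfun.scaleR_right monoms_apply[OF assms])
qed

lemma conv_monoms:
  assumes "u \<in> polydisc 1"
  shows "conv a b (monoms u) = a (monoms u) * b (monoms u)"
  by (simp add: conv_apply conv_fun_monoms[OF assms] blinfun.scaleR_right)

section \<open>Convergence of power series\<close>

definition unit_at :: "('n::finite \<Rightarrow> nat) \<Rightarrow> ('n \<Rightarrow> nat) \<Rightarrow>\<^sub>C real"
  where "unit_at \<alpha> = Bcontfun (\<lambda>\<beta>. if \<beta> = \<alpha> then 1 else 0)"

lemma unit_at_apply [simp]: "unit_at \<alpha> \<beta> = (if \<beta> = \<alpha> then 1 else 0)"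
  unfolding unit_at_def by (subst bcontfun_multi_index[where B = 1]) auto

lemma sum_unit_at_apply:
  assumes "finite S"
  shows "apply_bcontfun (\<Sum>\<alpha>\<in>S. f \<alpha> *\<^sub>R unit_at \<alpha>) \<beta> = (if \<beta> \<in> S then f \<beta> else 0)"
proof -
  have "apply_bcontfun (\<Sum>\<alpha>\<in>S. f \<alpha> *\<^sub>R unit_at \<alpha>) \<beta> = (\<Sum>\<alpha>\<in>S. if \<beta> = \<alpha> then f \<alpha> else 0)"
    using assms by (induction S rule: finite_induct) auto
  then show ?thesis using assms by simp
qed

text \<open>The convergence is in the sup norm. A multi-index outside the box of exponents below
  \<open>N\<close> has some exponent at least \<open>N\<close>, so its monomial is at most \<rho>^N;
  a finite set containing the box therefore leaves an error of at most \<rho>^N.\<close>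

lemma has_sum_monoms:
  fixes u :: "real ^ 'n"
  assumes u: "u \<in> polydisc \<rho>" and \<rho>: "0 \<le> \<rho>" "\<rho> < 1"
  shows "((\<lambda>\<alpha>. mv_monom \<alpha> u *\<^sub>R unit_at \<alpha>) has_sum monoms u) UNIV"
  unfolding has_sum_def
proof (rule tendstoI)
  fix e :: real assume "e > 0"
  obtain N where N: "\<rho> ^ N < e"
    using real_arch_pow_inv[OF \<open>e > 0\<close> \<rho>(2)] by blast
  let ?S = "PiE UNIV (\<lambda>_::'n. {..<N})"
  have u1: "u \<in> polydisc 1" using polydisc_mono[OF u] \<rho> by simp
  show "\<forall>\<^sub>F S in finite_subsets_at_top UNIV.
      dist (\<Sum>\<alpha>\<in>S. mv_monom \<alpha> u *\<^sub>R unit_at \<alpha>) (monoms u) < e"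
    unfolding eventually_finite_subsets_at_top
  proof (intro exI[of _ ?S] conjI allI impI)
    fix S :: "('n \<Rightarrow> nat) set" assume S: "finite S \<and> ?S \<subseteq> S \<and> S \<subseteq> UNIV"
    have "dist (\<Sum>\<alpha>\<in>S. mv_monom \<alpha> u *\<^sub>R unit_at \<alpha>) (monoms u) \<le> \<rho> ^ N"
    proof (rule dist_bound)
      fix \<beta>
      show "dist ((\<Sum>\<alpha>\<in>S. mv_monom \<alpha> u *\<^sub>R unit_at \<alpha>) \<beta>) (monoms u \<beta>) \<le> \<rho> ^ N"
      proof (cases "\<beta> \<in> S")
        case True
        then show ?thesis using S \<rho> by (simp add: sum_unit_at_apply monoms_apply[OF u1])
      next
        case False
        with S have "\<beta> \<notin> ?S" by blast
        then obtain i where "N \<le> \<beta> i" by (force simp: PiE_def not_less[symmetric])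
        then have "\<rho> ^ \<beta> i \<le> \<rho> ^ N" using \<rho> by (intro power_decreasing) auto
        moreover have "\<bar>mv_monom \<beta> u\<bar> \<le> \<rho> ^ \<beta> i"
          using abs_mv_monom_le[OF u] \<rho> by simp
        ultimately show ?thesis using False S
          by (simp add: sum_unit_at_apply monoms_apply[OF u1] dist_real_def)
      qed
    qed
    then show "dist (\<Sum>\<alpha>\<in>S. mv_monom \<alpha> u *\<^sub>R unit_at \<alpha>) (monoms u) < e"
      using N by simp
  qed (auto intro: finite_PiE)
qed

text \<open>Norm convergence lets any functional be applied term by term; its value at
  \<open>unit_at \<alpha>\<close> is the coefficient at \<alpha>.\<close>

lemma has_sum_series:
  fixes u :: "real ^ 'n"
  assumes "u \<in> polydisc \<rho>" "0 \<le> \<rho>" "\<rho> < 1"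
  shows "((\<lambda>\<alpha>. mv_monom \<alpha> u * blinfun_apply a (unit_at \<alpha>)) has_sum blinfun_apply a (monoms u)) UNIV"
  using has_sum_bounded_linear[OF blinfun.bounded_linear_right has_sum_monoms[OF assms], of a]
  by (simp add: blinfun.scaleR_right o_def)

section \<open>Lifting polynomials\<close>

text \<open>The first clause sends solutions of the lifted equation to solutions of the original
  one, the second embeds original solutions as constant series, and the third makes the lifted
  equation solvable near a known solution.\<close>

definition lifts :: "(real ^ 's \<Rightarrow> real) \<Rightarrow> ('n::finite series ^ 's \<Rightarrow> 'n series) \<Rightarrow> bool"
  where "lifts p P \<longleftrightarrow>
    (\<forall>u\<in>polydisc 1. \<forall>a. blinfun_apply (P a) (monoms u) = p (\<chi> s. blinfun_apply (a $ s) (monoms u))) \<and>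
    (\<forall>x. P (\<chi> s. x $ s *\<^sub>R one_series) = p x *\<^sub>R one_series) \<and>
    (\<forall>R. \<exists>L. L-lipschitz_on (cball 0 R) P)"

lemma linear_eq_sum_axis:
  fixes f :: "real ^ 's \<Rightarrow> real"
  assumes "bounded_linear f"
  shows "f x = (\<Sum>s\<in>UNIV. x $ s * f (axis s 1))"
proof -
  have "f x = f (\<Sum>s\<in>UNIV. x $ s *\<^sub>R axis s 1)"
    using basis_expansion[of x] by (simp add: scalar_mult_eq_scaleR)
  also have "\<dots> = (\<Sum>s\<in>UNIV. x $ s * f (axis s 1))"
    using assms by (simp add: linear_sum linear_scale bounded_linear.linear)
  finally show ?thesis .
qed

lemma ex_lipschitz_on_bounded_linear:
  assumes "bounded_linear f"
  shows "\<exists>L. L-lipschitz_on S f"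
  using assms by (meson bounded_linear.lipschitz_boundE lipschitz_on_subset subset_UNIV)

lemma ex_lipschitz_on_add:
  fixes f g :: "'a::metric_space \<Rightarrow> 'b::real_normed_vector"
  assumes "\<exists>L. L-lipschitz_on S f" "\<exists>L. L-lipschitz_on S g"
  shows "\<exists>L. L-lipschitz_on S (\<lambda>x. f x + g x)"
  using assms by (auto intro: lipschitz_on_add)

text \<open>A Lipschitz map is bounded on a ball, and a difference of products splits as in the
  product rule.\<close>

lemma ex_lipschitz_on_bilinear:
  fixes f :: "'a::real_normed_vector \<Rightarrow> 'b::real_normed_vector" and g :: "'a \<Rightarrow> 'c::real_normed_vector"
    and prod :: "'b \<Rightarrow> 'c \<Rightarrow> 'd::real_normed_vector"
  assumes "bounded_bilinear prod" and f: "L-lipschitz_on (cball 0 R) f" and g: "M-lipschitz_on (cball 0 R) g"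
  shows "\<exists>L. L-lipschitz_on (cball 0 R) (\<lambda>x. prod (f x) (g x))"
proof (cases "R \<ge> 0")
  case True
  interpret bounded_bilinear prod by fact
  obtain K where K: "K \<ge> 0" "\<And>a b. norm (prod a b) \<le> norm a * norm b * K"
    using nonneg_bounded by blast
  have L: "L \<ge> 0" "M \<ge> 0" using f g by (auto dest: lipschitz_on_nonneg)
  have bound: "norm (h x) \<le> norm (h 0) + N * R"
    if h: "N-lipschitz_on (cball 0 R) h" and x: "x \<in> cball 0 R"
    for h :: "'a \<Rightarrow> 'e::real_normed_vector" and N x
  proof -
    have "norm (h x - h 0) \<le> N * norm (x - 0)"
      using lipschitz_onD[OF h x, of 0] True by (simp add: dist_norm)
    also have "\<dots> \<le> N * R" using x lipschitz_on_nonneg[OF h] by (intro mult_left_mono) auto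
    finally show ?thesis using norm_triangle_ineq2[of "h x" "h 0"] by linarith
  qed
  define C where "C = L * (norm (g 0) + M * R) * K + (norm (f 0) + L * R) * M * K"
  have "C-lipschitz_on (cball 0 R) (\<lambda>x. prod (f x) (g x))"
  proof (rule lipschitz_onI)
    fix x y :: 'a assume x: "x \<in> cball 0 R" and y: "y \<in> cball 0 R"
    have "prod (f x) (g x) - prod (f y) (g y) = prod (f x - f y) (g x) + prod (f y) (g x - g y)"
      by (simp add: diff_left diff_right)
    also have "norm \<dots> \<le> norm (f x - f y) * norm (g x) * K + norm (f y) * norm (g x - g y) * K"
      by (intro norm_triangle_le add_mono K)
    also have "\<dots> \<le> (L * dist x y) * (norm (g 0) + M * R) * K + (norm (f 0) + L * R) * (M * dist x y) * K"
      using lipschitz_onD[OF f x y] lipschitz_onD[OF g x y] bound[OF f y] bound[OF g x] K L True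
      by (intro add_mono mult_mono) (auto simp: dist_norm)
    also have "\<dots> = C * dist x y" by (simp add: C_def algebra_simps)
    finally show "dist (prod (f x) (g x)) (prod (f y) (g y)) \<le> C * dist x y"
      by (simp add: dist_norm)
  qed (use K L True in \<open>auto simp: C_def\<close>)
  then show ?thesis by blast
next
  \<comment> \<open>A negative radius gives the empty ball.\<close>
  case False
  then show ?thesis by (auto simp: lipschitz_on_def)
qed

text \<open>The lift follows the construction of the polynomial, with \<open>conv\<close> as
  product. It commutes with evaluation because evaluation is multiplicative, and it keeps constant
  series constant because \<open>one_series\<close> is idempotent.\<close>

lemma lift_polynomial:
  fixes p :: "real ^ 's \<Rightarrow> real"
  assumes "real_polynomial_function p"
  shows "\<exists>P :: 'n::finite series ^ 's \<Rightarrow> 'n series. lifts p P"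
  using assms
proof (induction p rule: real_polynomial_function.induct)
  case (linear f)
  note f = linear_eq_sum_axis[OF linear]
  let ?P = "\<lambda>a :: 'n series ^ 's. \<Sum>s\<in>UNIV. f (axis s 1) *\<^sub>R (a $ s)"
  have "bounded_linear ?P"
    by (intro bounded_linear_sum bounded_linear_const_scaleR bounded_linear_vec_nth)
  then have "\<exists>L. L-lipschitz_on S ?P" for S by (rule ex_lipschitz_on_bounded_linear)
  moreover have "blinfun_apply (?P a) w = f (\<chi> s. blinfun_apply (a $ s) w)" for a w
    by (subst f) (simp add: blinfun.sum_left blinfun.scaleR_left mult.commute)
  moreover have "?P (\<chi> s. x $ s *\<^sub>R one_series) = f x *\<^sub>R one_series" for x
    by (subst f) (simp add: scaleR_sum_left mult.commute)
  ultimately have "lifts f ?P"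
    unfolding lifts_def by blast
  then show ?case by blast
next
  case (const c)
  have "lifts (\<lambda>_. c) (\<lambda>_ :: 'n series ^ 's. c *\<^sub>R one_series)"
    unfolding lifts_def
    by (auto simp: blinfun.scaleR_left monoms_apply mv_monom_def intro: lipschitz_intros)
  then show ?case by blast
next
  case (add p q)
  then obtain P Q :: "'n series ^ 's \<Rightarrow> 'n series" where PQ: "lifts p P" "lifts q Q" by blast
  have "\<exists>L. L-lipschitz_on (cball 0 R) (\<lambda>a. P a + Q a)" for R
    using PQ unfolding lifts_def by (simp add: ex_lipschitz_on_add)
  then have "lifts (\<lambda>x. p x + q x) (\<lambda>a. P a + Q a)"
    using PQ by (auto simp: lifts_def blinfun.add_left scaleR_add_left)
  then show ?case by blast
next
  case (mult p q)
  then obtain P Q :: "'n series ^ 's \<Rightarrow> 'n series" where PQ: "lifts p P" "lifts q Q" by blast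
  interpret conv: bounded_bilinear "conv :: 'n series \<Rightarrow> _" by (rule bounded_bilinear_conv)
  have "\<exists>L. L-lipschitz_on (cball 0 R) (\<lambda>a. conv (P a) (Q a))" for R
    using PQ ex_lipschitz_on_bilinear[OF bounded_bilinear_conv] unfolding lifts_def by blast
  then have "lifts (\<lambda>x. p x * q x) (\<lambda>a. conv (P a) (Q a))"
    using PQ by (auto simp: lifts_def conv_monoms conv.scaleR_left conv.scaleR_right conv_one_one)
  then show ?case by blast
qed

lemma ex_lipschitz_on_vec:
  fixes f :: "'a::metric_space \<Rightarrow> 'b::real_normed_vector ^ 's"
  assumes "\<And>s. \<exists>L. L-lipschitz_on S (\<lambda>x. f x $ s)"
  shows "\<exists>L. L-lipschitz_on S f"
proof -
  obtain L where L: "(L s)-lipschitz_on S (\<lambda>x. f x $ s)" for s using assms by metis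
  have "(\<Sum>s\<in>UNIV. L s)-lipschitz_on S f"
  proof (rule lipschitz_onI)
    fix x y assume xy: "x \<in> S" "y \<in> S"
    have "dist (f x) (f y) \<le> (\<Sum>s\<in>UNIV. dist (f x $ s) (f y $ s))"
      unfolding dist_vec_def by (rule L2_set_le_sum) simp
    also have "\<dots> \<le> (\<Sum>s\<in>UNIV. L s * dist x y)"
      by (intro sum_mono lipschitz_onD[OF L] xy)
    finally show "dist (f x) (f y) \<le> (\<Sum>s\<in>UNIV. L s) * dist x y"
      by (simp add: sum_distrib_right)
  qed (auto intro: sum_nonneg lipschitz_on_nonneg[OF L])
  then show ?thesis by blast
qed

lemma ex_lipschitz_on_polynomial:
  fixes p :: "'a::real_normed_vector \<Rightarrow> real"
  assumes "real_polynomial_function p"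
  shows "\<exists>L. L-lipschitz_on (cball 0 R) p"
  using assms
proof (induction p rule: real_polynomial_function.induct)
  case (linear f)
  then show ?case by (rule ex_lipschitz_on_bounded_linear)
next
  case (const c)
  show ?case by (auto intro: lipschitz_intros)
next
  case (add f g)
  then show ?case by (simp add: ex_lipschitz_on_add)
next
  case (mult f g)
  then show ?case using ex_lipschitz_on_bilinear[OF bounded_bilinear_mult] by blast
qed

section \<open>Differential equations on the unit interval\<close>

text \<open>
  The solution is sought as \<open>c t + exp (2 L t) *\<^sub>R U t\<close> with \<open>L\<close> a Lipschitz constant of \<open>G\<close> near the
  curve \<open>c\<close>; the exponential weight makes the Picard operator a contraction on all of \<open>[0,1]\<close>.
\<close>
lemma ode_solution_nearby:
  fixes G :: "'e::banach \<Rightarrow> 'e" and c :: "real \<Rightarrow> 'e"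
  assumes lip: "\<And>R. \<exists>L. L-lipschitz_on (cball 0 R) G"
    and c: "\<And>t. t \<in> {0..1} \<Longrightarrow> (c has_vector_derivative G (c t)) (at t within {0..1})"
  obtains \<epsilon> where "\<epsilon> > 0"
    and "\<And>v0. norm (v0 - c 0) \<le> \<epsilon> \<Longrightarrow>
      \<exists>v. v 0 = v0 \<and> (\<forall>t\<in>{0..1}. (v has_vector_derivative G (v t)) (at t within {0..1}))"
proof -
  have cont_c: "continuous_on {0..1} c"
    by (rule continuous_on_vector_derivative[OF c])
  then have "bounded (c ` {0..1})"
    by (intro compact_imp_bounded compact_continuous_image) auto
  then obtain B where B: "norm (c t) \<le> B" if "t \<in> {0..1}" for t
    by (metis bounded_iff imageI)
  obtain L0 where L0: "L0-lipschitz_on (cball 0 (B + 1)) G" using lip by blast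
  define L where "L = L0 + 1"
  have L: "L-lipschitz_on (cball 0 (B + 1)) G" "L > 0"
    using L0 lipschitz_on_nonneg[OF L0] by (auto simp: L_def intro: lipschitz_on_le)
  \<comment> \<open>The weight is at most exp (2 L) on [0,1], so a \<open>U\<close> of norm at most
    \<rho> moves the curve by at most 1 and keeps it in the ball where \<open>L\<close> is
    valid.\<close>
  define \<rho> where "\<rho> = exp (- 2 * L)"
  have \<rho>: "\<rho> > 0" "\<And>t. t \<in> {0..1} \<Longrightarrow> exp (2 * L * t) * \<rho> \<le> 1"
    using L(2) by (auto simp: \<rho>_def mult_exp_exp)
  \<comment> \<open>As \<open>c\<close> solves the equation, \<open>V U\<close> is the solution
    starting at \<open>v0\<close> exactly when \<open>V U t - c t = v0 - c 0 + J U t\<close> on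
    [0,1].\<close>
  define V where "V U t = c t + exp (2 * L * t) *\<^sub>R apply_bcontfun U t" for U :: "real \<Rightarrow>\<^sub>C 'e" and t
  define D where "D U t = G (V U t) - G (c t)" for U :: "real \<Rightarrow>\<^sub>C 'e" and t
  define J where "J U t = integral {0..t} (D U)" for U :: "real \<Rightarrow>\<^sub>C 'e" and t
  have V_in: "V U t \<in> cball 0 (B + 1)" if "U \<in> cball 0 \<rho>" "t \<in> {0..1}" for U t
  proof -
    have "norm (apply_bcontfun U t) \<le> \<rho>" using norm_bounded[of U t] that by simp
    then have "exp (2 * L * t) * norm (apply_bcontfun U t) \<le> 1"
      using \<rho>(2)[OF that(2)] by (meson exp_ge_zero mult_left_mono order_trans)
    then have "norm (V U t) \<le> norm (c t) + 1"
      unfolding V_def by (intro norm_triangle_le) auto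
    then show ?thesis using B[OF that(2)] by simp
  qed
  have c_in: "c t \<in> cball 0 (B + 1)" if "t \<in> {0..1}" for t using B[OF that] by simp
  have cont_V: "continuous_on {0..1} (V U)" for U
    unfolding V_def by (intro continuous_intros cont_c continuous_on_apply_bcontfun)
  have cont_G: "continuous_on (cball 0 (B + 1)) G"
    by (rule lipschitz_on_continuous_on[OF L(1)])
  have cont_D: "continuous_on {0..1} (D U)" if "U \<in> cball 0 \<rho>" for U
    unfolding D_def using V_in[OF that] c_in
    by (intro continuous_intros continuous_on_compose2[OF cont_G] cont_V cont_c) auto
  have D_diff: "norm (D U t - D U' t) \<le> L * exp (2 * L * t) * norm (U - U')"
    if "U \<in> cball 0 \<rho>" "U' \<in> cball 0 \<rho>" "t \<in> {0..1}" for U U' t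
  proof -
    have "norm (D U t - D U' t) \<le> L * norm (V U t - V U' t)"
      using lipschitz_onD[OF L(1) V_in[OF that(1,3)] V_in[OF that(2,3)]]
      by (simp add: D_def dist_norm)
    also have "V U t - V U' t = exp (2 * L * t) *\<^sub>R apply_bcontfun (U - U') t"
      by (simp add: V_def algebra_simps)
    also have "norm \<dots> \<le> exp (2 * L * t) * norm (U - U')"
      using norm_bounded[of "U - U'" t] by simp
    finally show ?thesis using L(2) by simp
  qed
  \<comment> \<open>The integral of L exp (2 L s) over [0,t] is at most exp (2 L t) / 2; the weight
    cancels the exponential and leaves the contraction factor 1/2.\<close>
  have J_diff: "exp (- 2 * L * t) * norm (J U t - J U' t) \<le> norm (U - U') / 2"
    if U: "U \<in> cball 0 \<rho>" "U' \<in> cball 0 \<rho>" and t: "t \<in> {0..1}" for U U' t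
  proof -
    let ?N = "norm (U - U')"
    have int: "D W integrable_on {0..t}" if "W \<in> cball 0 \<rho>" for W
      using t by (intro integrable_continuous_real continuous_on_subset[OF cont_D[OF that]]) auto
    have "((\<lambda>s. L * exp (2 * L * s) * ?N) has_integral
        exp (2 * L * t) / 2 * ?N - exp (2 * L * 0) / 2 * ?N) {0..t}"
      using t by (intro fundamental_theorem_of_calculus)
        (auto intro!: derivative_eq_intros simp flip: has_real_derivative_iff_has_vector_derivative)
    then have I: "(\<lambda>s. L * exp (2 * L * s) * ?N) integrable_on {0..t}"
      "integral {0..t} (\<lambda>s. L * exp (2 * L * s) * ?N) \<le> exp (2 * L * t) / 2 * ?N"
      by (auto simp: has_integral_iff)
    have "J U t - J U' t = integral {0..t} (\<lambda>s. D U s - D U' s)"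
      unfolding J_def by (rule Henstock_Kurzweil_Integration.integral_diff[symmetric, OF int int]) (use U in auto)
    also have "norm \<dots> \<le> integral {0..t} (\<lambda>s. L * exp (2 * L * s) * ?N)"
      using t U by (intro integral_norm_bound_integral integrable_diff int I D_diff) auto
    also note I(2)
    finally have "exp (- 2 * L * t) * norm (J U t - J U' t) \<le> exp (- 2 * L * t) * (exp (2 * L * t) / 2 * ?N)"
      by (intro mult_left_mono) auto
    also have "\<dots> = ?N / 2" by (simp add: exp_minus field_simps)
    finally show ?thesis .
  qed
  \<comment> \<open>With this, \<open>J_diff\<close> against 0 bounds \<open>J U\<close>
    itself.\<close>
  have "D 0 = (\<lambda>_. 0)" by (auto simp: D_def V_def)
  then have J_zero: "J 0 t = 0" for t by (simp add: J_def)
  show ?thesis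
  \<comment> \<open>Half of \<rho> is spent on the initial displacement and the other half on
    \<open>J U\<close>, so the Picard operator maps the ball of radius \<rho> into itself.\<close>
  proof (rule that[of "\<rho> / 2"])
    fix v0 assume v0: "norm (v0 - c 0) \<le> \<rho> / 2"
    define f where "f U t = exp (- 2 * L * t) *\<^sub>R (v0 - c 0 + J U t)" for U t
    \<comment> \<open>Elements of the function space live on the whole line; clamping extends the
      image constantly beyond [0,1].\<close>
    have "\<exists>g. \<forall>t. apply_bcontfun g t = f U (clamp 0 1 t)" if U: "U \<in> cball 0 \<rho>" for U
    proof -
      have "continuous_on (cbox 0 1) (f U)"
        unfolding f_def J_def cbox_interval using cont_D[OF U]
        by (intro continuous_intros indefinite_integral_continuous_1 integrable_continuous_real)
      then show ?thesis by (rule continuous_on_cbox_bcontfunE) blast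
    qed
    then obtain T where T: "apply_bcontfun (T U) t = f U (clamp 0 1 t)" if "U \<in> cball 0 \<rho>" for U t
      by metis
    have clamp: "clamp 0 1 t \<in> {0..1}" for t :: real
      using clamp_in_interval[of 0 1 t] by (simp add: cbox_interval)
    have "\<exists>!U. U \<in> cball 0 \<rho> \<and> T U = U"
    proof (rule Banach_fix[where c = "1/2"])
      show "T ` cball 0 \<rho> \<subseteq> cball 0 \<rho>"
      proof (rule image_subsetI)
        fix U :: "real \<Rightarrow>\<^sub>C 'e" assume "U \<in> cball 0 \<rho>"
        then have U: "norm U \<le> \<rho>" by simp
        have "norm (T U) \<le> \<rho>"
        proof (rule norm_bound)
          fix t :: real
          let ?t = "clamp 0 1 t"
          have "norm (T U t) \<le> exp (- 2 * L * ?t) * (norm (v0 - c 0) + norm (J U ?t))"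
            using U by (simp add: T f_def norm_triangle_ineq)
          also have "\<dots> = exp (- 2 * L * ?t) * norm (v0 - c 0) + exp (- 2 * L * ?t) * norm (J U ?t)"
            by (simp add: algebra_simps)
          also have "exp (- 2 * L * ?t) * norm (J U ?t) \<le> norm U / 2"
            using J_diff[of U 0 ?t] U \<rho>(1) clamp[of t] by (simp add: J_zero)
          also have "exp (- 2 * L * ?t) * norm (v0 - c 0) \<le> 1 * norm (v0 - c 0)"
            using clamp[of t] L(2) by (intro mult_right_mono) auto
          finally show "norm (T U t) \<le> \<rho>" using U v0 by simp
        qed
        then show "T U \<in> cball 0 \<rho>" by simp
      qed
      show "dist (T U) (T U') \<le> 1/2 * dist U U'" if "U \<in> cball 0 \<rho>" "U' \<in> cball 0 \<rho>" for U U'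
      proof (rule dist_bound)
        fix t :: real
        let ?t = "clamp 0 1 t"
        have "T U t - T U' t = exp (- 2 * L * ?t) *\<^sub>R (J U ?t - J U' ?t)"
          using that by (simp add: T f_def algebra_simps)
        then show "dist (T U t) (T U' t) \<le> 1/2 * dist U U'"
          using J_diff[OF that clamp[of t]] by (simp add: dist_norm)
      qed
    qed (use \<rho> in \<open>auto simp: complete_eq_closed\<close>)
    then obtain U where U: "U \<in> cball 0 \<rho>" "T U = U" by blast
    have V_eq: "V U t = c t + (v0 - c 0 + J U t)" if "t \<in> {0..1}" for t
    proof -
      have "clamp 0 1 t = t" using that by (intro clamp_cancel_cbox) (auto simp: cbox_interval)
      then have "apply_bcontfun U t = f U t" using T[OF U(1), of t] U(2) by simp
      then show ?thesis by (simp add: V_def f_def exp_minus)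
    qed
    have "(V U has_vector_derivative G (V U t)) (at t within {0..1})" if t: "t \<in> {0..1}" for t
    proof (rule has_vector_derivative_transform[OF t V_eq])
      have "((\<lambda>t. c t + (v0 - c 0 + J U t)) has_vector_derivative G (c t) + (0 + D U t)) (at t within {0..1})"
        unfolding J_def
        by (intro has_vector_derivative_add has_vector_derivative_const c[OF t]
            integral_has_vector_derivative cont_D[OF U(1)] t)
      then show "((\<lambda>t. c t + (v0 - c 0 + J U t)) has_vector_derivative G (V U t)) (at t within {0..1})"
        by (simp add: D_def)
    qed
    moreover have "V U 0 = v0" using V_eq[of 0] by (simp add: J_def)
    ultimately show "\<exists>v. v 0 = v0 \<and> (\<forall>t\<in>{0..1}. (v has_vector_derivative G (v t)) (at t within {0..1}))"
      by blast
  qed (use \<rho> in auto)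
qed

text \<open>Gronwall's argument: the squared distance weighted by exp (- 2 L s) starts at 0, and its
  derivative is nonpositive by Cauchy-Schwarz and the Lipschitz bound.\<close>

lemma ode_solution_unique:
  fixes G :: "'e::real_inner \<Rightarrow> 'e" and y v :: "real \<Rightarrow> 'e"
  assumes lip: "\<And>R. \<exists>L. L-lipschitz_on (cball 0 R) G"
    and y: "\<And>t. t \<in> {0..1} \<Longrightarrow> (y has_vector_derivative G (y t)) (at t within {0..1})"
    and v: "\<And>t. t \<in> {0..1} \<Longrightarrow> (v has_vector_derivative G (v t)) (at t within {0..1})"
    and init: "y 0 = v 0" and t: "t \<in> {0..1}"
  shows "y t = v t"
proof -
  have bdd: "bounded (z ` {0..1})"
    if "\<And>t. t \<in> {0..1} \<Longrightarrow> (z has_vector_derivative G (z t)) (at t within {0..1})" for z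
    using continuous_on_vector_derivative[OF that]
    by (intro compact_imp_bounded compact_continuous_image) auto
  have "bounded (y ` {0..1} \<union> v ` {0..1})" using bdd[OF y] bdd[OF v] by simp
  then obtain R where "\<And>x. x \<in> y ` {0..1} \<union> v ` {0..1} \<Longrightarrow> norm x \<le> R"
    by (auto simp only: bounded_iff)
  then have R: "y s \<in> cball 0 R" "v s \<in> cball 0 R" if "s \<in> {0..1}" for s using that by auto
  obtain L where L: "L-lipschitz_on (cball 0 R) G" using lip by blast
  define d where "d s = y s - v s" for s
  define f where "f s = exp (- 2 * L * s) * (d s \<bullet> d s)" for s
  define f' where "f' s = exp (- 2 * L * s) * (2 * (d s \<bullet> (G (y s) - G (v s))) - 2 * L * (d s \<bullet> d s))" for s
  have der: "(f has_real_derivative f' s) (at s within {0..1})" if s: "s \<in> {0..1}" for s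
  proof -
    have d: "(d has_vector_derivative (G (y s) - G (v s))) (at s within {0..1})"
      unfolding d_def by (intro has_vector_derivative_diff y v s)
    have "((\<lambda>s. d s \<bullet> d s) has_vector_derivative
        d s \<bullet> (G (y s) - G (v s)) + (G (y s) - G (v s)) \<bullet> d s) (at s within {0..1})"
      by (rule bounded_bilinear.has_vector_derivative[OF bounded_bilinear_inner d d])
    then have "((\<lambda>s. d s \<bullet> d s) has_real_derivative 2 * (d s \<bullet> (G (y s) - G (v s)))) (at s within {0..1})"
      by (simp add: has_real_derivative_iff_has_vector_derivative inner_commute)
    then show ?thesis unfolding f_def f'_def
      by (auto intro!: derivative_eq_intros simp: algebra_simps)
  qed
  have nonpos: "f' s \<le> 0" if s: "s \<in> {0..1}" for s
  proof -
    have "d s \<bullet> (G (y s) - G (v s)) \<le> norm (d s) * norm (G (y s) - G (v s))"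
      by (rule norm_cauchy_schwarz)
    also have "\<dots> \<le> norm (d s) * (L * norm (d s))"
      using lipschitz_onD[OF L R(1)[OF s] R(2)[OF s]]
      by (intro mult_left_mono) (auto simp: d_def dist_norm)
    also have "\<dots> = L * (d s \<bullet> d s)" by (simp add: power2_norm_eq_inner[symmetric] power2_eq_square)
    finally show ?thesis unfolding f'_def by (intro mult_nonneg_nonpos) auto
  qed
  have "\<exists>s\<in>{0..t}. f t - f 0 = f' s * (t - 0)"
  proof (rule mvt_very_simple)
    show "(f has_derivative (*) (f' s)) (at s within {0..t})" if "0 \<le> s" "s \<le> t" for s
      using has_field_derivative_subset[OF der[of s], of "{0..t}"] that t
      by (auto simp: has_field_derivative_def)
  qed (use t in auto)
  then have "f t \<le> 0" using nonpos t by (auto simp: f_def d_def init mult_nonpos_nonneg)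
  then have "d t \<bullet> d t \<le> 0" by (simp add: f_def mult_le_0_iff not_le)
  then have "d t = 0" by (meson inner_gt_zero_iff not_le)
  then show ?thesis by (simp add: d_def)
qed

section \<open>Analytic dependence on parameters\<close>

lemma mv_monom_scaleR: "mv_monom \<alpha> (c *\<^sub>R v) = mv_monom \<alpha> (\<chi> i. c) * mv_monom \<alpha> v"
  by (simp add: mv_monom_def power_mult_distrib prod.distrib)

lemma bounded_linear_vecI:
  fixes f :: "'a::real_normed_vector \<Rightarrow> 'b::real_normed_vector ^ 's"
  assumes "\<And>s. bounded_linear (\<lambda>x. f x $ s)"
  shows "bounded_linear f"
proof -
  have "\<exists>K. \<forall>x. norm (f x $ s) \<le> norm x * K" for s
    using bounded_linear.bounded[OF assms] .
  then obtain K where K: "norm (f x $ s) \<le> norm x * K s" for x s by metis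
  show ?thesis
  proof (rule bounded_linear_intro)
    show "norm (f x) \<le> norm x * (\<Sum>s\<in>UNIV. K s)" for x
    proof -
      have "norm (f x) \<le> (\<Sum>s\<in>UNIV. norm (f x $ s))"
        unfolding norm_vec_def by (rule L2_set_le_sum) simp
      also have "\<dots> \<le> (\<Sum>s\<in>UNIV. norm x * K s)" by (intro sum_mono K)
      finally show ?thesis by (simp add: sum_distrib_left)
    qed
  qed (use assms[THEN bounded_linear.linear] in \<open>auto simp: vec_eq_iff linear_iff\<close>)
qed

lemma has_sum_vecI:
  fixes f :: "'a \<Rightarrow> 'b::real_normed_vector ^ 's"
  assumes "\<And>s. ((\<lambda>x. f x $ s) has_sum l $ s) S"
  shows "(f has_sum l) S"
  using assms unfolding has_sum_def by (auto intro!: vec_tendstoI simp: sum_component)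

text \<open>The parameter enters only through the initial value, and affinely, so the lifted initial
  value is a constant series plus a multiple of a fixed linear one.\<close>

lemma polynomial_flow_real_analytic:
  fixes X :: "(real ^ 'n) set" and y :: "real ^ 'n \<Rightarrow> real \<Rightarrow> real ^ 's"
    and G :: "real ^ 's \<Rightarrow> real ^ 's" and p :: "'m::finite \<Rightarrow> real ^ 's \<Rightarrow> real"
    and \<phi> :: "real ^ 'n \<Rightarrow> real ^ 'm"
  assumes X: "open X"
    and G: "\<And>s. real_polynomial_function (\<lambda>x. G x $ s)"
    and p: "\<And>i. real_polynomial_function (p i)"
    and M: "bounded_linear M"
    and init: "\<And>\<xi>. \<xi> \<in> X \<Longrightarrow> y \<xi> 0 = b + M \<xi>"
    and sol: "\<And>\<xi> t. \<xi> \<in> X \<Longrightarrow> t \<in> {0..1} \<Longrightarrow>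
      (y \<xi> has_vector_derivative G (y \<xi> t)) (at t within {0..1})"
    and \<phi>: "\<And>\<xi> i. \<xi> \<in> X \<Longrightarrow> \<phi> \<xi> $ i = p i (y \<xi> 1)"
  shows "real_analytic_on \<phi> X"
  unfolding real_analytic_on_def
proof
  fix x assume x: "x \<in> X"
  obtain g :: "'s \<Rightarrow> 'n series ^ 's \<Rightarrow> 'n series" where g: "lifts (\<lambda>x. G x $ s) (g s)" for s
    using lift_polynomial[OF G] by metis
  obtain P :: "'m \<Rightarrow> 'n series ^ 's \<Rightarrow> 'n series" where P: "lifts (p i) (P i)" for i
    using choice[of "\<lambda>i. lifts (p i)"] lift_polynomial[OF p] by blast
  define \<G> where "\<G> a = (\<chi> s. g s a)" for a
  define \<iota> :: "real ^ 's \<Rightarrow> 'n series ^ 's" where "\<iota> v = (\<chi> s. v $ s *\<^sub>R one_series)" for v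
  define E :: "real ^ 'n \<Rightarrow> 'n series ^ 's \<Rightarrow> real ^ 's"
    where "E u a = (\<chi> s. blinfun_apply (a $ s) (monoms u))" for u a
  \<comment> \<open>The linear map \<open>M\<close> written as a vector of series: a combination of
    the coordinate monomials.\<close>
  define W :: "'n series ^ 's"
    where "W = (\<chi> s. \<Sum>j\<in>UNIV. (M (axis j 1) $ s) *\<^sub>R coeff_at (\<lambda>i. if i = j then 1 else 0))"
  have lip_\<G>: "\<exists>L. L-lipschitz_on (cball 0 R) \<G>" for R
    using g by (intro ex_lipschitz_on_vec) (auto simp: \<G>_def lifts_def)
  have lip_G: "\<exists>L. L-lipschitz_on (cball 0 R) G" for R
    by (intro ex_lipschitz_on_vec ex_lipschitz_on_polynomial G)
  have \<G>_\<iota>: "\<G> (\<iota> v) = \<iota> (G v)" for v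
    using g by (simp add: \<G>_def \<iota>_def lifts_def vec_eq_iff)
  have E_\<G>: "E u (\<G> a) = G (E u a)" if "u \<in> polydisc 1" for u a
    using g that by (simp add: \<G>_def E_def lifts_def vec_eq_iff)
  have lin_\<iota>: "bounded_linear \<iota>"
    unfolding \<iota>_def by (intro bounded_linear_vecI)
      (simp add: bounded_linear_scaleR_const bounded_linear_vec_nth)
  have lin_E: "bounded_linear (E u)" for u
    unfolding E_def by (intro bounded_linear_vecI)
      (simp add: bounded_linear_compose[OF blinfun.bounded_linear_left bounded_linear_vec_nth])
  have E_\<iota>: "E u (\<iota> v) = v" if "u \<in> polydisc 1" for u v
    using that by (simp add: E_def \<iota>_def vec_eq_iff blinfun.scaleR_left monoms_apply mv_monom_def)
  have E_W: "E u W = M u" if u: "u \<in> polydisc 1" for u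
  proof -
    have "mv_monom (\<lambda>i. if i = j then 1 else 0) u = u $ j" for j
      by (simp add: mv_monom_def if_distrib[of "\<lambda>k. _ ^ k"] cong: if_cong)
    moreover have "M u = (\<Sum>j\<in>UNIV. u $ j *\<^sub>R M (axis j 1))"
      using basis_expansion[of u] M
      by (metis (no_types, lifting) bounded_linear.linear linear_sum linear_scale scalar_mult_eq_scaleR sum.cong)
    ultimately show ?thesis
      using u by (simp add: E_def W_def vec_eq_iff blinfun.sum_left blinfun.scaleR_left
          monoms_apply sum_component mult.commute)
  qed
  \<comment> \<open>The trajectory at \<open>x\<close>, seen as a curve of constant series, is the
    known lifted solution to be perturbed.\<close>
  have c: "((\<lambda>t. \<iota> (y x t)) has_vector_derivative \<G> (\<iota> (y x t))) (at t within {0..1})"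
    if "t \<in> {0..1}" for t
    unfolding \<G>_\<iota> by (rule bounded_linear.has_vector_derivative[OF lin_\<iota> sol[OF x that]])
  obtain \<epsilon> where \<epsilon>: "\<epsilon> > 0" and near: "\<And>v0. norm (v0 - \<iota> (y x 0)) \<le> \<epsilon> \<Longrightarrow>
      \<exists>v. v 0 = v0 \<and> (\<forall>t\<in>{0..1}. (v has_vector_derivative \<G> (v t)) (at t within {0..1}))"
    using ode_solution_nearby[OF lip_\<G> c] by blast
  \<comment> \<open>Chosen so that \<rho> W is an admissible displacement; adding 1 keeps the
    denominator positive.\<close>
  define \<rho> where "\<rho> = \<epsilon> / (norm W + 1)"
  have \<rho>: "\<rho> > 0" "\<rho> * norm W \<le> \<epsilon>"
    using \<epsilon> norm_ge_zero[of W] by (auto simp: \<rho>_def field_simps add_pos_nonneg)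
  obtain v where v0: "v 0 = \<iota> (y x 0) + \<rho> *\<^sub>R W"
    and v: "\<And>t. t \<in> {0..1} \<Longrightarrow> (v has_vector_derivative \<G> (v t)) (at t within {0..1})"
    using near[of "\<iota> (y x 0) + \<rho> *\<^sub>R W"] \<rho> by auto
  obtain r0 where r0: "r0 > 0" "ball x r0 \<subseteq> X" using X x by (auto simp: open_contains_ball)
  \<comment> \<open>The bound \<rho> / 2 puts \<open>u\<close> into the polydisc of radius 1/2,
    strictly inside the unit one, where the series converges.\<close>
  define r where "r = min r0 (\<rho> / 2)"
  have r: "r > 0" "ball x r \<subseteq> X" using r0 \<rho> by (auto simp: r_def)
  \<comment> \<open>The scalar factor is (1/\<rho>)^|\<alpha>|; it turns the expansion in
    \<open>u\<close> into one in \<xi> - x.\<close>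
  define C where "C \<alpha> = mv_monom \<alpha> (\<chi> i. 1 / \<rho>) *\<^sub>R (\<chi> i. blinfun_apply (P i (v 1)) (unit_at \<alpha>))" for \<alpha>
  have "((\<lambda>\<alpha>. mv_monom \<alpha> (\<xi> - x) *\<^sub>R C \<alpha>) has_sum \<phi> \<xi>) UNIV" if \<xi>: "\<xi> \<in> ball x r" for \<xi>
  proof -
    define u where "u = (1 / \<rho>) *\<^sub>R (\<xi> - x)"
    have half: "u \<in> polydisc (1/2)"
    proof -
      have "\<bar>(\<xi> - x) $ i\<bar> \<le> \<rho> / 2" for i
        using component_le_norm_cart[of "\<xi> - x" i] \<xi> by (simp add: r_def dist_norm norm_minus_commute)
      then show ?thesis using \<rho> by (simp add: polydisc_def u_def field_simps)
    qed
    then have u: "u \<in> polydisc 1" by (rule polydisc_mono) simp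
    have \<xi>X: "\<xi> \<in> X" using \<xi> r by blast
    \<comment> \<open>At \<open>u\<close> the displacement \<rho> W evaluates to M (\<xi> - x), so
      the evaluated lifted solution starts where \<open>y \<xi>\<close> does and uniqueness
      identifies the two.\<close>
    have "y \<xi> 0 = y x 0 + \<rho> *\<^sub>R M u"
      using init[OF x] init[OF \<xi>X] M \<rho>
      by (simp add: u_def linear_scale linear_diff bounded_linear.linear)
    then have "E u (v 0) = y \<xi> 0"
      using lin_E[of u] E_\<iota>[OF u] E_W[OF u]
      by (simp add: v0 linear_add linear_scale bounded_linear.linear)
    moreover have "((\<lambda>t. E u (v t)) has_vector_derivative G (E u (v t))) (at t within {0..1})"
      if "t \<in> {0..1}" for t
      unfolding E_\<G>[OF u, symmetric]
      by (rule bounded_linear.has_vector_derivative[OF lin_E v[OF that]])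
    ultimately have "E u (v 1) = y \<xi> 1"
      using ode_solution_unique[OF lip_G _ sol[OF \<xi>X], of "\<lambda>t. E u (v t)" 1] by simp
    then have eval: "blinfun_apply (P i (v 1)) (monoms u) = \<phi> \<xi> $ i" for i
      using P[of i] u \<phi>[OF \<xi>X, of i] by (simp add: lifts_def E_def)
    show ?thesis
    proof (rule has_sum_vecI)
      fix i
      have "((\<lambda>\<alpha>. mv_monom \<alpha> u * blinfun_apply (P i (v 1)) (unit_at \<alpha>)) has_sum \<phi> \<xi> $ i) UNIV"
        using has_sum_series[OF half, of "P i (v 1)"] by (simp add: eval)
      then show "((\<lambda>\<alpha>. (mv_monom \<alpha> (\<xi> - x) *\<^sub>R C \<alpha>) $ i) has_sum \<phi> \<xi> $ i) UNIV"
        unfolding u_def by (subst (asm) mv_monom_scaleR) (simp add: C_def mult_ac)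
    qed
  qed
  then show "\<exists>r>0. ball x r \<subseteq> X \<and> (\<exists>c. \<forall>y\<in>ball x r.
      ((\<lambda>\<alpha>. mv_monom \<alpha> (y - x) *\<^sub>R c \<alpha>) has_sum \<phi> y) UNIV)"
    using r by blast
qed

section \<open>Reduction of a rational system to a polynomial one\<close>

text \<open>Polynomial partial derivatives are what makes the equation for the reciprocal of the
  denominator polynomial.\<close>

lemma real_polynomial_function_gradient:
  fixes q :: "real ^ 'k \<Rightarrow> real"
  assumes "real_polynomial_function q"
  shows "\<exists>q'. (\<forall>i. real_polynomial_function (q' i)) \<and>
    (\<forall>z. (q has_derivative (\<lambda>h. \<Sum>i\<in>UNIV. q' i z * h $ i)) (at z))"
  using assms
proof (induction q rule: real_polynomial_function.induct)
  case (linear f)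
  have "(f has_derivative (\<lambda>h. \<Sum>i\<in>UNIV. f (axis i 1) * h $ i)) (at z)" for z
  proof -
    have "(f has_derivative f) (at z)" by (rule bounded_linear_imp_has_derivative[OF linear])
    moreover have "f = (\<lambda>h. \<Sum>i\<in>UNIV. f (axis i 1) * h $ i)"
      by (rule ext, subst linear_eq_sum_axis[OF linear]) (simp add: mult.commute)
    ultimately show ?thesis by metis
  qed
  then show ?case
    by (intro exI[of _ "\<lambda>i _. f (axis i 1)"]) (simp add: real_polynomial_function.intros(2))
next
  case (const c)
  show ?case by (intro exI[of _ "\<lambda>_ _. 0"]) (simp add: real_polynomial_function.intros(2))
next
  case (add f g)
  from add.IH(1) obtain f' where f': "\<And>i. real_polynomial_function (f' i)"
    "\<And>z. (f has_derivative (\<lambda>h. \<Sum>i\<in>UNIV. f' i z * h $ i)) (at z)"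
    by blast
  from add.IH(2) obtain g' where g': "\<And>i. real_polynomial_function (g' i)"
    "\<And>z. (g has_derivative (\<lambda>h. \<Sum>i\<in>UNIV. g' i z * h $ i)) (at z)"
    by blast
  show ?case
  proof (intro exI[of _ "\<lambda>i z. f' i z + g' i z"] conjI allI)
    show "real_polynomial_function (\<lambda>z. f' i z + g' i z)" for i
      using f'(1) g'(1) by (intro real_polynomial_function.intros(3))
    show "((\<lambda>z. f z + g z) has_derivative (\<lambda>h. \<Sum>i\<in>UNIV. (f' i z + g' i z) * h $ i)) (at z)" for z
      using has_derivative_add[OF f'(2) g'(2), of z] by (simp add: distrib_right sum.distrib)
  qed
next
  case (mult f g)
  from mult.IH(1) obtain f' where f': "\<And>i. real_polynomial_function (f' i)"
    "\<And>z. (f has_derivative (\<lambda>h. \<Sum>i\<in>UNIV. f' i z * h $ i)) (at z)"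
    by blast
  from mult.IH(2) obtain g' where g': "\<And>i. real_polynomial_function (g' i)"
    "\<And>z. (g has_derivative (\<lambda>h. \<Sum>i\<in>UNIV. g' i z * h $ i)) (at z)"
    by blast
  show ?case
  proof (intro exI[of _ "\<lambda>i z. f z * g' i z + f' i z * g z"] conjI allI)
    show "real_polynomial_function (\<lambda>z. f z * g' i z + f' i z * g z)" for i
      using f'(1) g'(1) mult.hyps by (intro real_polynomial_function.intros(3) real_polynomial_function.intros(4))
    show "((\<lambda>z. f z * g z) has_derivative
        (\<lambda>h. \<Sum>i\<in>UNIV. (f z * g' i z + f' i z * g z) * h $ i)) (at z)" for z
      using has_derivative_mult[OF f'(2) g'(2), of z]
      by (simp add: algebra_simps sum.distrib sum_distrib_left)
  qed
qed

text \<open>Each numerator absorbs the denominators of the other functions, so one additional state,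
  the reciprocal of the product, clears all of them.\<close>

lemma rational_on_common_denominator:
  fixes f :: "'i::finite \<Rightarrow> real ^ 'k \<Rightarrow> real"
  assumes "\<And>i. rational_on Z (f i)"
  shows "\<exists>p q. (\<forall>i. real_polynomial_function (p i)) \<and> real_polynomial_function q \<and>
    (\<forall>z\<in>Z. q z \<noteq> 0 \<and> (\<forall>i. f i z = p i z / q z))"
proof -
  obtain p q where pq: "real_polynomial_function (p i)" "real_polynomial_function (q i)"
    "\<And>z. z \<in> Z \<Longrightarrow> q i z \<noteq> 0" "\<And>z. z \<in> Z \<Longrightarrow> f i z = p i z / q i z" for i
    using assms unfolding rational_on_def by metis
  show ?thesis
  proof (intro exI[of _ "\<lambda>i z. p i z * (\<Prod>j\<in>UNIV - {i}. q j z)"] exI[of _ "\<lambda>z. \<Prod>j\<in>UNIV. q j z"]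
      conjI allI ballI)
    show "f i z = p i z * (\<Prod>j\<in>UNIV - {i}. q j z) / (\<Prod>j\<in>UNIV. q j z)" if "z \<in> Z" for i z
      using pq(3)[OF that] by (simp add: pq(4)[OF that] prod.remove[of UNIV i "\<lambda>j. q j z"])
  qed (use pq in \<open>auto intro!: real_polynomial_function.intros(4) real_polynomial_function_prod\<close>)
qed

lemma has_vector_derivative_vecI:
  fixes f :: "real \<Rightarrow> 'b::real_normed_vector ^ 's"
  assumes "\<And>s. ((\<lambda>t. f t $ s) has_vector_derivative f' $ s) (at t within S)"
  shows "(f has_vector_derivative f') (at t within S)"
  unfolding has_vector_derivative_def has_derivative_within
proof (intro conjI vec_tendstoI)
  fix s
  show "((\<lambda>y. ((1 / norm (y - t)) *\<^sub>R (f y - (f t + (y - t) *\<^sub>R f'))) $ s) \<longlongrightarrow> 0 $ s) (at t within S)"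
    using assms[of s] by (simp add: has_vector_derivative_def has_derivative_within)
qed (rule bounded_linear_scaleR_left)

theorem theorem2:
  fixes X :: "(real ^ 'n) set"
    and \<phi> :: "real ^ 'n \<Rightarrow> real ^ 'm"
    and Z :: "(real ^ 'k) set"
    and F :: "real ^ 'k \<Rightarrow> real ^ 'n ^ 'k"
    and h :: "real ^ 'k \<Rightarrow> real ^ 'm"
    and z0 :: "real ^ 'k"
  assumes "open X"
    and "is_R_FISCIDS X \<phi> Z F h z0"
  shows "real_analytic_on \<phi> X"
proof -
  \<comment> \<open>The entries of \<open>F\<close> and \<open>h\<close> form one family, so that
    they share a denominator.\<close>
  define f where "f s z = (case s of Inl (i, j) \<Rightarrow> F z $ i $ j | Inr i \<Rightarrow> h z $ i)"
    for s :: "('k \<times> 'n) + 'm" and z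
  have "rational_on Z (f s)" for s
    using assms(2) by (cases s) (auto simp: is_R_FISCIDS_def f_def[abs_def])
  then obtain p q where p: "\<And>s. real_polynomial_function (p s)" and q: "real_polynomial_function q"
    and q_nz: "\<And>z. z \<in> Z \<Longrightarrow> q z \<noteq> 0" and f_eq: "\<And>s z. z \<in> Z \<Longrightarrow> f s z = p s z / q z"
    using rational_on_common_denominator[of Z f] by blast
  obtain q' where q': "\<And>i. real_polynomial_function (q' i)"
    and der_q: "\<And>z. (q has_derivative (\<lambda>h. \<Sum>i\<in>UNIV. q' i z * h $ i)) (at z)"
    using real_polynomial_function_gradient[OF q] by blast
  obtain z where z: "is_trajectory Z F z0 \<xi> (z \<xi>)" "h (z \<xi> 1) = \<phi> \<xi>" if "\<xi> \<in> X" for \<xi>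
    using assms(2) unfolding is_R_FISCIDS_def is_FISCIDS_def by metis
  \<comment> \<open>The enlarged state has the reciprocal of \<open>q\<close> at
    \<open>None\<close>, the old state at \<open>Inl\<close> and the input at
    \<open>Inr\<close>.\<close>
  define \<pi> :: "real ^ ('k + 'n) option \<Rightarrow> real ^ 'k" where "\<pi> x = (\<chi> i. x $ Some (Inl i))" for x
  \<comment> \<open>The old vector field, with division by \<open>q\<close> replaced by
    multiplication by the \<open>None\<close> coordinate.\<close>
  define V :: "'k \<Rightarrow> real ^ ('k + 'n) option \<Rightarrow> real"
    where "V i x = (\<Sum>j\<in>UNIV. p (Inl (i, j)) (\<pi> x) * x $ Some (Inr j)) * x $ None" for i x
  \<comment> \<open>The \<open>None\<close> component is the chain rule for 1/q along the flow; the
    input components vanish because the input is constant.\<close>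
  define G :: "real ^ ('k + 'n) option \<Rightarrow> real ^ ('k + 'n) option"
    where "G x = (\<chi> s. case s of None \<Rightarrow> - (x $ None)\<^sup>2 * (\<Sum>i\<in>UNIV. q' i (\<pi> x) * V i x)
      | Some (Inl i) \<Rightarrow> V i x | Some (Inr j) \<Rightarrow> 0)" for x
  define y :: "real ^ 'n \<Rightarrow> real \<Rightarrow> real ^ ('k + 'n) option"
    where "y \<xi> t = (\<chi> s. case s of None \<Rightarrow> inverse (q (z \<xi> t))
      | Some (Inl i) \<Rightarrow> z \<xi> t $ i | Some (Inr j) \<Rightarrow> \<xi> $ j)" for \<xi> t
  define b :: "real ^ ('k + 'n) option"
    where "b = (\<chi> s. case s of None \<Rightarrow> inverse (q z0) | Some (Inl i) \<Rightarrow> z0 $ i | Some (Inr j) \<Rightarrow> 0)"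
  define M :: "real ^ 'n \<Rightarrow> real ^ ('k + 'n) option"
    where "M \<xi> = (\<chi> s. case s of Some (Inr j) \<Rightarrow> \<xi> $ j | _ \<Rightarrow> 0)" for \<xi>
  have nth: "real_polynomial_function (\<lambda>x. x $ s)" for s :: "('k + 'n) option"
    by (intro real_polynomial_function.intros(1) bounded_linear_vec_nth)
  have "bounded_linear \<pi>"
    unfolding \<pi>_def by (intro bounded_linear_vecI) (simp add: bounded_linear_vec_nth)
  then have comp_\<pi>: "real_polynomial_function (\<lambda>x. g (\<pi> x))" if "real_polynomial_function g" for g
    using real_polynomial_function_compose[OF polynomial_function_bounded_linear that] by (simp add: o_def)
  have V: "real_polynomial_function (V i)" for i
    unfolding V_def
    by (intro real_polynomial_function.intros(4) real_polynomial_function_sum comp_\<pi> p nth) auto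
  have G: "real_polynomial_function (\<lambda>x. G x $ s)" for s
  proof (cases s)
    case None
    then show ?thesis
      unfolding G_def
      by (simp, intro real_polynomial_function_minus real_polynomial_function.intros(4)
          real_polynomial_function_power real_polynomial_function_sum comp_\<pi> q' V nth) auto
  next
    case (Some s')
    then show ?thesis
      using V by (cases s') (auto simp: G_def real_polynomial_function.intros(2))
  qed
  have M: "bounded_linear M"
  proof (rule bounded_linear_vecI)
    fix s :: "('k + 'n) option"
    consider "s = None" | i where "s = Some (Inl i)" | j where "s = Some (Inr j)"
      by (metis option.exhaust sum.exhaust)
    then show "bounded_linear (\<lambda>\<xi>. M \<xi> $ s)"
      by cases (simp_all add: M_def bounded_linear_vec_nth)
  qed
  have init: "y \<xi> 0 = b + M \<xi>" if "\<xi> \<in> X" for \<xi>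
  proof -
    have "z \<xi> 0 = z0" using z(1)[OF that] by (simp add: is_trajectory_def)
    then show ?thesis
      unfolding y_def b_def M_def by (subst vec_eq_iff) (auto split: option.split sum.split)
  qed
  have sol: "(y \<xi> has_vector_derivative G (y \<xi> t)) (at t within {0..1})"
    if \<xi>: "\<xi> \<in> X" and t: "t \<in> {0..1}" for \<xi> t
  proof -
    have zZ: "z \<xi> t \<in> Z"
      and der_z: "(z \<xi> has_vector_derivative F (z \<xi> t) *v \<xi>) (at t within {0..1})"
      using z(1)[OF \<xi>] t by (auto simp: is_trajectory_def)
    have \<pi>_y: "\<pi> (y \<xi> t) = z \<xi> t" by (simp add: \<pi>_def y_def vec_eq_iff)
    have Fv: "(F (z \<xi> t) *v \<xi>) $ i = V i (y \<xi> t)" for i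
    proof -
      have "F (z \<xi> t) $ i $ j = p (Inl (i, j)) (z \<xi> t) / q (z \<xi> t)" for j
        using f_eq[OF zZ, of "Inl (i, j)"] by (simp add: f_def)
      then show ?thesis
        by (simp add: matrix_vector_mult_def V_def \<pi>_y) (simp add: y_def sum_distrib_left divide_inverse mult_ac)
    qed
    have "((\<lambda>t. q (z \<xi> t)) has_derivative
        (\<lambda>h. \<Sum>i\<in>UNIV. q' i (z \<xi> t) * (h *\<^sub>R (F (z \<xi> t) *v \<xi>)) $ i)) (at t within {0..1})"
      using has_derivative_compose[OF der_z[unfolded has_vector_derivative_def] der_q] .
    then have der_qz: "((\<lambda>t. q (z \<xi> t)) has_real_derivative
        (\<Sum>i\<in>UNIV. q' i (z \<xi> t) * V i (y \<xi> t))) (at t within {0..1})"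
      unfolding has_field_derivative_def
      by (rule has_derivative_eq_rhs) (simp add: fun_eq_iff Fv sum_distrib_left mult_ac)
    show ?thesis
    proof (rule has_vector_derivative_vecI)
      fix s
      show "((\<lambda>t. y \<xi> t $ s) has_vector_derivative G (y \<xi> t) $ s) (at t within {0..1})"
      proof (cases s)
        case None
        have "((\<lambda>t. inverse (q (z \<xi> t))) has_real_derivative
            - ((inverse (q (z \<xi> t)))\<^sup>2 * (\<Sum>i\<in>UNIV. q' i (z \<xi> t) * V i (y \<xi> t)))) (at t within {0..1})"
          using DERIV_inverse'[OF der_qz q_nz[OF zZ]] by (simp add: power2_eq_square mult_ac)
        moreover have "y \<xi> t $ None = inverse (q (z \<xi> t))" for t by (simp add: y_def)
        ultimately show ?thesis
          using None by (simp add: G_def \<pi>_y has_real_derivative_iff_has_vector_derivative)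
      next
        case (Some s')
        show ?thesis
        proof (cases s')
          case (Inl i)
          have "((\<lambda>t. z \<xi> t $ i) has_vector_derivative V i (y \<xi> t)) (at t within {0..1})"
            using bounded_linear.has_vector_derivative[OF bounded_linear_vec_nth der_z, of i] by (simp add: Fv)
          then show ?thesis using Some Inl by (simp add: G_def) (simp add: y_def)
        next
          case (Inr j)
          then show ?thesis using Some by (simp add: G_def) (simp add: y_def)
        qed
      qed
    qed
  qed
  show ?thesis
  proof (rule polynomial_flow_real_analytic[OF assms(1) G _ M init sol,
        \<comment> \<open>The output is rational in the old state, but polynomial once the
          reciprocal of \<open>q\<close> is a coordinate.\<close>
        where p = "\<lambda>i x. p (Inr i) (\<pi> x) * x $ None"])
    show "real_polynomial_function (\<lambda>x. p (Inr i) (\<pi> x) * x $ None)" for i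
      by (intro real_polynomial_function.intros(4) comp_\<pi> p nth)
    fix \<xi> i assume \<xi>: "\<xi> \<in> X"
    then have "z \<xi> 1 \<in> Z" using z(1) by (simp add: is_trajectory_def)
    then have "\<phi> \<xi> $ i = p (Inr i) (z \<xi> 1) / q (z \<xi> 1)"
      using f_eq[of "z \<xi> 1" "Inr i"] z(2)[OF \<xi>] by (simp add: f_def)
    then show "\<phi> \<xi> $ i = p (Inr i) (\<pi> (y \<xi> 1)) * y \<xi> 1 $ None"
      by (simp add: \<pi>_def y_def divide_inverse)
  qed
qed

end
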